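(* For any non-principal ultrafilter $U$ on $\omega$, the ultrapower $\mathcal{R}_U$ of $\mathcal{R}$ induced by $U$ is isomorphic to the generic model $\mathcal{R}_{\beta(U)}$ determined by $\beta(U)$. Conversely, for any generic filter $G$ on $\mathfrak{F}$, the generic model $\mathcal{R}_G$ is isomorphic to the ultrapower $\mathcal{R}_{\alpha(G)}$ of $\mathcal{R}$ induced by $\alpha(G)$.
   Context: Background theory: ZF + Dependent Choices. $\mathfrak{F}$ is the set of all proper filters on $\omega$ that contain every cofinite subset of $\omega$, ordered by reverse inclusion. A subset $D\subseteq\mathfrak{F}$ is dense if for any $F\in\mathfrak{F}$ there is $F'\in D$ with $F\subseteq F'$. A generic filter on $\mathfrak{F}$ is a subset $G\subseteq\mathfrak{F}$ that is directed (for any $F,F'\in G$ there is $H\in G$ with $H\supseteq F,F'$), upward closed ($F\subseteq F'\in G$ with $F\in\mathfrak{F}$ implies $F\in G$), and has non-empty intersection with every dense subset of $\mathfrak{F}$. $\mathscr{L}$ is the first-order language (with equality) with a relation symbol for every finitary relation on $\mathbb{R}$ and a function symbol for every finitary function on $\mathbb{R}$; $\mathcal{R}$ is the $\mathscr{L}$-structure with domain $\mathbb{R}$ with the obvious interpretation. Generic model: for a generic filter $G$ on $\mathfrak{F}$, $\mathcal{R}_G$ is the $\mathscr{L}$-structure defined as follows. For $a,a'\in\mathbb{R}^\omega$, $a\sim_G a'$ iff there is $F\in G$ with $\{i\in\omega:a(i)=a'(i)\}\in F$; the domain of $\mathcal{R}_G$ is the set of $\sim_G$-classes $a_G$; for a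 relation symbol $R$, $\mathcal{R}_G\models R(\overline{a_G})$ iff there is $F\in G$ with $\{i\in\omega:\mathcal{R}\models R(\overline{a}(i))\}\in F$; function symbols are interpreted pointwise on representatives. For a generic filter $G$ on $\mathfrak{F}$, $\alpha(G)=\bigcup G$, which is a non-principal ultrafilter on $\omega$; for a non-principal ultrafilter $U$ on $\omega$, $\beta(U)=\{F\in\mathfrak{F}:F\subseteq U\}$, which is a generic filter on $\mathfrak{F}$. The ultrapower $\mathcal{R}_U$ is the usual ultrapower $\mathcal{R}^\omega/U$ as an $\mathscr{L}$-structure. *)

theory Defs
  imports Complex_Main "HOL-Library.FuncSet"
begin

text \<open>
  Filters on \<open>\<omega>\<close> are elements of the library type \<^typ>\<open>nat filter\<close>; a set \<open>X\<close> belongs to \<open>F\<close> iff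
  \<open>eventually (\<lambda>i. i \<in> X) F\<close>.  The library order on filters is reverse inclusion, so
  \<open>F' \<le> F\<close> means \<open>F \<subseteq> F'\<close>, and it is exactly the forcing order.
\<close>

section \<open>First-order languages, structures and isomorphisms\<close>

record ('r, 'f) fo_lang =
  rel_syms :: "'r set"
  rel_arity :: "'r \<Rightarrow> nat"
  fun_syms :: "'f set"
  fun_arity :: "'f \<Rightarrow> nat"

record ('r, 'f, 'a) fo_struct =
  universe :: "'a set"
  rel_int :: "'r \<Rightarrow> 'a list \<Rightarrow> bool"
  fun_int :: "'f \<Rightarrow> 'a list \<Rightarrow> 'a"

text \<open>Tuples of length \<open>n\<close> are lists of length \<open>n\<close>.\<close>

definition tuples :: "nat \<Rightarrow> 'a set \<Rightarrow> 'a list set" where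
  "tuples n A = {xs. length xs = n \<and> set xs \<subseteq> A}"

definition is_fo_struct :: "('r, 'f) fo_lang \<Rightarrow> ('r, 'f, 'a) fo_struct \<Rightarrow> bool" where
  "is_fo_struct L M \<longleftrightarrow> universe M \<noteq> {} \<and>
     (\<forall>f\<in>fun_syms L. \<forall>xs\<in>tuples (fun_arity L f) (universe M). fun_int M f xs \<in> universe M)"

definition fo_iso ::
  "('r, 'f) fo_lang \<Rightarrow> ('r, 'f, 'a) fo_struct \<Rightarrow> ('r, 'f, 'b) fo_struct \<Rightarrow> ('a \<Rightarrow> 'b) \<Rightarrow> bool" where
  "fo_iso L M N h \<longleftrightarrow> bij_betw h (universe M) (universe N) \<and>
     (\<forall>R\<in>rel_syms L. \<forall>xs\<in>tuples (rel_arity L R) (universe M).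
        rel_int M R xs \<longleftrightarrow> rel_int N R (map h xs)) \<and>
     (\<forall>f\<in>fun_syms L. \<forall>xs\<in>tuples (fun_arity L f) (universe M).
        h (fun_int M f xs) = fun_int N f (map h xs))"

definition fo_isomorphic ::
  "('r, 'f) fo_lang \<Rightarrow> ('r, 'f, 'a) fo_struct \<Rightarrow> ('r, 'f, 'b) fo_struct \<Rightarrow> bool" where
  "fo_isomorphic L M N \<longleftrightarrow> is_fo_struct L M \<and> is_fo_struct L N \<and> (\<exists>h. fo_iso L M N h)"

section \<open>The full language of the reals and its standard structure\<close>

text \<open>
  The symbols are the finitary relations and functions on the reals themselves, tagged with
  their arity (the tag distinguishes the empty relations of different arities).  An \<open>n\<close>-ary
  function is made \<^const>\<open>extensional\<close> so that it is determined by its values on \<open>n\<close>-tuples.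
\<close>

type_synonym real_rel = "nat \<times> real list set"
type_synonym real_fun = "nat \<times> (real list \<Rightarrow> real)"

definition real_lang :: "(real_rel, real_fun) fo_lang" where
  "real_lang = \<lparr>
     rel_syms = {(n, R). R \<subseteq> tuples n UNIV}, rel_arity = fst,
     fun_syms = {(n, f). f \<in> extensional (tuples n UNIV)}, fun_arity = fst \<rparr>"

definition real_struct :: "(real_rel, real_fun, real) fo_struct" where
  "real_struct = \<lparr>
     universe = UNIV,
     rel_int = (\<lambda>R xs. xs \<in> snd R),
     fun_int = (\<lambda>f xs. snd f xs) \<rparr>"

section \<open>Ultrafilters and ultrapowers\<close>

definition ultrafilter :: "'i filter \<Rightarrow> bool" where
  "ultrafilter U \<longleftrightarrow> U \<noteq> bot \<and>
     (\<forall>X. eventually (\<lambda>i. i \<in> X) U \<or> eventually (\<lambda>i. i \<in> - X) U)"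

definition nonprincipal_ultrafilter :: "'i filter \<Rightarrow> bool" where
  "nonprincipal_ultrafilter U \<longleftrightarrow> ultrafilter U \<and> (\<forall>i. U \<noteq> principal {i})"

definition ultra_eq :: "'a set \<Rightarrow> 'i filter \<Rightarrow> (('i \<Rightarrow> 'a) \<times> ('i \<Rightarrow> 'a)) set" where
  "ultra_eq A U = {(a, b). range a \<subseteq> A \<and> range b \<subseteq> A \<and> eventually (\<lambda>i. a i = b i) U}"

text \<open>
  Below, \<open>list_all2 (\<in>) as cs\<close> says that \<open>as\<close> is a list of representatives of the classes in the
  list \<open>cs\<close>, and \<open>map (\<lambda>a. a i) as\<close> is the \<open>i\<close>-th coordinate tuple of \<open>as\<close>.
\<close>

definition ultrapower ::
  "('r, 'f, 'a) fo_struct \<Rightarrow> 'i filter \<Rightarrow> ('r, 'f, ('i \<Rightarrow> 'a) set) fo_struct" where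
  "ultrapower M U = \<lparr>
     universe = {a. range a \<subseteq> universe M} // ultra_eq (universe M) U,
     rel_int = (\<lambda>R cs. \<exists>as. list_all2 (\<in>) as cs \<and>
       eventually (\<lambda>i. rel_int M R (map (\<lambda>a. a i) as)) U),
     fun_int = (\<lambda>f cs. THE c. \<exists>as. list_all2 (\<in>) as cs \<and>
       c = ultra_eq (universe M) U `` {\<lambda>i. fun_int M f (map (\<lambda>a. a i) as)}) \<rparr>"

section \<open>Generic filters and generic models\<close>

definition Frk :: "nat filter set" where
  "Frk = {F. F \<noteq> bot \<and> (\<forall>X. finite (- X) \<longrightarrow> eventually (\<lambda>i. i \<in> X) F)}"

definition dense_in_Frk :: "nat filter set \<Rightarrow> bool" where
  "dense_in_Frk D \<longleftrightarrow> D \<subseteq> Frk \<and> (\<forall>F\<in>Frk. \<exists>F'\<in>D. F' \<le> F)"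

definition generic_filter :: "nat filter set \<Rightarrow> bool" where
  "generic_filter G \<longleftrightarrow> G \<subseteq> Frk \<and>
     (\<forall>F\<in>G. \<forall>F'\<in>G. \<exists>H\<in>G. H \<le> F \<and> H \<le> F') \<and>
     (\<forall>F\<in>Frk. \<forall>F'\<in>G. F' \<le> F \<longrightarrow> F \<in> G) \<and>
     (\<forall>D. dense_in_Frk D \<longrightarrow> G \<inter> D \<noteq> {})"

definition generic_eq :: "nat filter set \<Rightarrow> ((nat \<Rightarrow> real) \<times> (nat \<Rightarrow> real)) set" where
  "generic_eq G = {(a, b). \<exists>F\<in>G. eventually (\<lambda>i. a i = b i) F}"

definition generic_model ::
  "nat filter set \<Rightarrow> (real_rel, real_fun, (nat \<Rightarrow> real) set) fo_struct" where
  "generic_model G = \<lparr>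
     universe = UNIV // generic_eq G,
     rel_int = (\<lambda>R cs. \<exists>as. list_all2 (\<in>) as cs \<and>
       (\<exists>F\<in>G. eventually (\<lambda>i. rel_int real_struct R (map (\<lambda>a. a i) as)) F)),
     fun_int = (\<lambda>f cs. THE c. \<exists>as. list_all2 (\<in>) as cs \<and>
       c = generic_eq G `` {\<lambda>i. fun_int real_struct f (map (\<lambda>a. a i) as)}) \<rparr>"

text \<open>
  \<open>\<alpha>(G) = \<Union>G\<close>, formed on the level of the predicates belonging to the filters;
  lemma \<open>eventually_alpha\<close> shows that this really is a filter when \<open>G\<close> is generic.
\<close>

definition alpha :: "nat filter set \<Rightarrow> nat filter" where
  "alpha G = Abs_filter (\<lambda>P. \<exists>F\<in>G. eventually P F)"

definition beta :: "nat filter \<Rightarrow> nat filter set" where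
  "beta U = {F \<in> Frk. U \<le> F}"

section \<open>Well-definedness\<close>

lemma Frk_iff: "F \<in> Frk \<longleftrightarrow> F \<noteq> bot \<and> F \<le> cofinite"
proof -
  have "(\<forall>X. finite (- X) \<longrightarrow> eventually (\<lambda>i. i \<in> X) F) \<longleftrightarrow> F \<le> cofinite"
  proof
    assume L: "\<forall>X. finite (- X) \<longrightarrow> eventually (\<lambda>i. i \<in> X) F"
    show "F \<le> cofinite"
    proof (rule filter_leI)
      fix P :: "nat \<Rightarrow> bool" assume "eventually P cofinite"
      then have "finite (- Collect P)" by (simp add: eventually_cofinite Compl_eq)
      with L show "eventually P F" by fastforce
    qed
  next
    assume "F \<le> cofinite"
    then show "\<forall>X. finite (- X) \<longrightarrow> eventually (\<lambda>i. i \<in> X) F"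
      by (auto simp: le_filter_def eventually_cofinite Compl_eq)
  qed
  then show ?thesis by (simp add: Frk_def)
qed

lemma generic_nonempty:
  assumes "generic_filter G" shows "G \<noteq> {}"
proof -
  have "dense_in_Frk Frk" by (auto simp: dense_in_Frk_def)
  with assms show ?thesis unfolding generic_filter_def by blast
qed

lemma eventually_alpha:
  assumes G: "generic_filter G"
  shows "eventually P (alpha G) \<longleftrightarrow> (\<exists>F\<in>G. eventually P F)"
  unfolding alpha_def
proof (rule eventually_Abs_filter, standard)
  show "\<exists>F\<in>G. eventually (\<lambda>x. True) F" using generic_nonempty[OF G] by auto
next
  fix P Q assume "\<exists>F\<in>G. eventually P F" "\<exists>F\<in>G. eventually Q F"
  then obtain F F' where F: "F \<in> G" "F' \<in> G" "eventually P F" "eventually Q F'" by blast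
  with G obtain H where "H \<in> G" "H \<le> F" "H \<le> F'" unfolding generic_filter_def by blast
  moreover from this F have "eventually P H" "eventually Q H" by (auto dest: filter_leD)
  ultimately show "\<exists>F\<in>G. eventually (\<lambda>x. P x \<and> Q x) F"
    by (auto intro: eventually_conj)
next
  fix P Q :: "nat \<Rightarrow> bool"
  assume "\<forall>x. P x \<longrightarrow> Q x" "\<exists>F\<in>G. eventually P F"
  then show "\<exists>F\<in>G. eventually Q F" by (meson eventually_mono)
qed

lemma ultrafilter_le_eq:
  assumes U: "ultrafilter U" and F: "F \<noteq> bot" "F \<le> U"
  shows "F = U"
proof (rule antisym[OF F(2)], rule filter_leI)
  fix P assume P: "eventually P F"
  have "eventually P U \<or> eventually (\<lambda>i. \<not> P i) U"
    using U unfolding ultrafilter_def by (auto dest: spec[of _ "Collect P"])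
  moreover have "\<not> eventually (\<lambda>i. \<not> P i) U"
  proof
    assume "eventually (\<lambda>i. \<not> P i) U"
    then have "eventually (\<lambda>i. \<not> P i) F" using F(2) by (rule filter_leD[rotated])
    with P have "eventually (\<lambda>i. False) F" by eventually_elim simp
    with F(1) show False by (simp add: trivial_limit_def)
  qed
  ultimately show "eventually P U" by blast
qed

lemma nonprincipal_in_Frk:
  assumes U: "nonprincipal_ultrafilter U" shows "U \<in> Frk"
proof -
  have nb: "U \<noteq> bot" and ult: "ultrafilter U"
    using U by (auto simp: nonprincipal_ultrafilter_def ultrafilter_def)
  have pt: "eventually (\<lambda>j. j \<noteq> i) U" for i
  proof (rule ccontr)
    assume "\<not> ?thesis"
    then have "eventually (\<lambda>j. j \<in> {i}) U"
      using ult unfolding ultrafilter_def by (auto dest: spec[of _ "{i}"])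
    then have "U \<le> principal {i}" by (simp add: le_principal)
    moreover have "ultrafilter (principal {i})"
      by (auto simp: ultrafilter_def eventually_principal principal_eq_bot_iff)
    ultimately have "U = principal {i}" using ultrafilter_le_eq nb by blast
    with U show False by (simp add: nonprincipal_ultrafilter_def)
  qed
  have "eventually (\<lambda>i. i \<in> X) U" if "finite (- X)" for X
  proof -
    have "eventually (\<lambda>j. \<forall>i\<in>- X. j \<noteq> i) U"
      using that pt by (intro eventually_ball_finite) auto
    then show ?thesis by eventually_elim auto
  qed
  with nb show ?thesis by (simp add: Frk_def)
qed

lemma generic_beta:
  assumes U: "nonprincipal_ultrafilter U" shows "generic_filter (beta U)"
proof -
  have UF: "U \<in> Frk" by (rule nonprincipal_in_Frk[OF U])
  have ult: "ultrafilter U" using U by (simp add: nonprincipal_ultrafilter_def)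
  have "beta U \<inter> D \<noteq> {}" if D: "dense_in_Frk D" for D
  proof -
    obtain F where F: "F \<in> D" "F \<le> U" "F \<in> Frk" using D UF unfolding dense_in_Frk_def by blast
    then have "F = U" using ultrafilter_le_eq[OF ult] by (simp add: Frk_def)
    with F UF show ?thesis by (auto simp: beta_def)
  qed
  moreover have "\<exists>H\<in>beta U. H \<le> F \<and> H \<le> F'" if "F \<in> beta U" "F' \<in> beta U" for F F'
    using that UF by (intro bexI[of _ U]) (auto simp: beta_def)
  ultimately show ?thesis unfolding generic_filter_def by (auto simp: beta_def)
qed

lemma nonprincipal_alpha:
  assumes G: "generic_filter G" shows "nonprincipal_ultrafilter (alpha G)"
proof -
  note ev = eventually_alpha[OF G]
  have GF: "G \<subseteq> Frk" using G by (simp add: generic_filter_def)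
  have nb: "alpha G \<noteq> bot"
    unfolding trivial_limit_def ev using GF by (auto simp: Frk_def trivial_limit_def)
  have "eventually (\<lambda>i. i \<in> X) (alpha G) \<or> eventually (\<lambda>i. i \<in> - X) (alpha G)" for X
  proof -
    let ?D = "{F \<in> Frk. eventually (\<lambda>i. i \<in> X) F \<or> eventually (\<lambda>i. i \<in> - X) F}"
    have "\<exists>F'\<in>?D. F' \<le> F" if F: "F \<in> Frk" for F
    proof (cases "eventually (\<lambda>i. i \<in> - X) F")
      case True with F show ?thesis by auto
    next
      case False
      let ?F = "inf F (principal X)"
      have "?F \<noteq> bot"
        using False by (simp add: trivial_limit_def eventually_inf_principal)
      moreover have "?F \<le> cofinite" using F by (auto simp: Frk_iff intro: le_infI1)
      moreover have "eventually (\<lambda>i. i \<in> X) ?F" by (simp add: eventually_inf_principal)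
      ultimately show ?thesis by (intro bexI[of _ ?F]) (auto simp: Frk_iff)
    qed
    then have "dense_in_Frk ?D" by (auto simp: dense_in_Frk_def)
    then have "G \<inter> ?D \<noteq> {}" using G unfolding generic_filter_def by blast
    then show ?thesis unfolding ev by blast
  qed
  with nb have "ultrafilter (alpha G)" by (simp add: ultrafilter_def)
  moreover have "alpha G \<noteq> principal {i}" for i
  proof
    assume *: "alpha G = principal {i}"
    obtain F where "F \<in> G" using generic_nonempty[OF G] by blast
    moreover have "eventually (\<lambda>j. j \<in> - {i}) F"
      using GF \<open>F \<in> G\<close> by (auto simp: Frk_def simp del: Compl_iff)
    ultimately have "eventually (\<lambda>j. j \<in> - {i}) (alpha G)" unfolding ev by blast
    then show False unfolding * by (simp add: eventually_principal)
  qed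
  ultimately show ?thesis by (simp add: nonprincipal_ultrafilter_def)
qed

lemma equiv_ultra_eq: "equiv {a. range a \<subseteq> A} (ultra_eq A U)"
proof (rule equivI)
  show "ultra_eq A U \<subseteq> {a. range a \<subseteq> A} \<times> {a. range a \<subseteq> A}"
    by (auto simp: ultra_eq_def)
  show "refl_on {a. range a \<subseteq> A} (ultra_eq A U)"
    by (auto simp: refl_on_def ultra_eq_def)
  show "sym (ultra_eq A U)" by (auto simp: sym_def ultra_eq_def eq_commute)
  show "trans (ultra_eq A U)"
    by (auto simp: trans_def ultra_eq_def elim: eventually_elim2)
qed

lemma generic_eq_alpha:
  "generic_filter G \<Longrightarrow> generic_eq G = ultra_eq UNIV (alpha G)"
  by (auto simp: generic_eq_def ultra_eq_def eventually_alpha)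

lemma equiv_generic_eq: "generic_filter G \<Longrightarrow> equiv UNIV (generic_eq G)"
  using equiv_ultra_eq[of UNIV "alpha G"] by (simp add: generic_eq_alpha)

lemma representatives_eventually_eq:
  assumes "list_all2 (\<in>) bs (map (\<lambda>a. ultra_eq A U `` {a}) as)"
  shows "eventually (\<lambda>i. map (\<lambda>a. a i) as = map (\<lambda>b. b i) bs) U"
  using assms
proof (induction as arbitrary: bs)
  case Nil then show ?case by simp
next
  case (Cons a as)
  then obtain b bs' where bs: "bs = b # bs'"
    and b: "b \<in> ultra_eq A U `` {a}"
    and bs': "list_all2 (\<in>) bs' (map (\<lambda>a. ultra_eq A U `` {a}) as)"
    by (auto simp: list_all2_Cons2)
  have "eventually (\<lambda>i. a i = b i) U" using b by (simp add: ultra_eq_def)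
  with Cons.IH[OF bs'] show ?case unfolding bs by eventually_elim simp
qed

lemma representatives_refl:
  assumes "set as \<subseteq> {a. range a \<subseteq> A}"
  shows "list_all2 (\<in>) as (map (\<lambda>a. ultra_eq A U `` {a}) as)"
  using assms by (induction as) (auto simp: ultra_eq_def)

lemma ultrapower_rel_int:
  assumes "set as \<subseteq> {a. range a \<subseteq> universe M}"
  shows "rel_int (ultrapower M U) R (map (\<lambda>a. ultra_eq (universe M) U `` {a}) as)
    \<longleftrightarrow> eventually (\<lambda>i. rel_int M R (map (\<lambda>a. a i) as)) U"
proof
  assume "rel_int (ultrapower M U) R (map (\<lambda>a. ultra_eq (universe M) U `` {a}) as)"
  then obtain bs where bs: "list_all2 (\<in>) bs (map (\<lambda>a. ultra_eq (universe M) U `` {a}) as)"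
    and R: "eventually (\<lambda>i. rel_int M R (map (\<lambda>a. a i) bs)) U"
    by (auto simp: ultrapower_def)
  from R representatives_eventually_eq[OF bs]
  show "eventually (\<lambda>i. rel_int M R (map (\<lambda>a. a i) as)) U"
    by eventually_elim simp
next
  assume "eventually (\<lambda>i. rel_int M R (map (\<lambda>a. a i) as)) U"
  with representatives_refl[OF assms, of U]
  show "rel_int (ultrapower M U) R (map (\<lambda>a. ultra_eq (universe M) U `` {a}) as)"
    by (auto simp: ultrapower_def)
qed

lemma ultrapower_fun_int:
  assumes as: "set as \<subseteq> {a. range a \<subseteq> universe M}"
    and closed: "\<And>xs. length xs = length as \<Longrightarrow> set xs \<subseteq> universe M \<Longrightarrow> fun_int M f xs \<in> universe M"
  shows "fun_int (ultrapower M U) f (map (\<lambda>a. ultra_eq (universe M) U `` {a}) as)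
    = ultra_eq (universe M) U `` {\<lambda>i. fun_int M f (map (\<lambda>a. a i) as)}"
proof -
  let ?E = "ultra_eq (universe M) U"
  let ?cs = "map (\<lambda>a. ?E `` {a}) as"
  let ?p = "\<lambda>as i. fun_int M f (map (\<lambda>a. a i) as)"
  have "(THE c. \<exists>bs. list_all2 (\<in>) bs ?cs \<and> c = ?E `` {?p bs}) = ?E `` {?p as}"
  proof (rule the_equality)
    show "\<exists>bs. list_all2 (\<in>) bs ?cs \<and> ?E `` {?p as} = ?E `` {?p bs}"
      using representatives_refl[OF as, of U] by blast
  next
    fix c assume "\<exists>bs. list_all2 (\<in>) bs ?cs \<and> c = ?E `` {?p bs}"
    then obtain bs where bs: "list_all2 (\<in>) bs ?cs" and c: "c = ?E `` {?p bs}" by blast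
    have len: "length bs = length as" using bs by (auto dest: list_all2_lengthD)
    have "set bs \<subseteq> {a. range a \<subseteq> universe M}"
      using bs by (fastforce simp: list_all2_conv_all_nth in_set_conv_nth ultra_eq_def)
    then have rb: "range (?p bs) \<subseteq> universe M" using len by (fastforce intro!: closed)
    have ra: "range (?p as) \<subseteq> universe M" using as by (fastforce intro!: closed)
    have "eventually (\<lambda>i. ?p as i = ?p bs i) U"
      using representatives_eventually_eq[OF bs] by eventually_elim simp
    with ra rb have "(?p as, ?p bs) \<in> ?E" by (simp add: ultra_eq_def)
    with equiv_class_eq[OF equiv_ultra_eq] c show "c = ?E `` {?p as}" by blast
  qed
  then show ?thesis by (simp add: ultrapower_def)
qed

lemma generic_model_rel_int:
  assumes G: "generic_filter G"
  shows "rel_int (generic_model G) R (map (\<lambda>a. generic_eq G `` {a}) as)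
    \<longleftrightarrow> (\<exists>F\<in>G. eventually (\<lambda>i. rel_int real_struct R (map (\<lambda>a. a i) as)) F)"
  using ultrapower_rel_int[of as real_struct "alpha G" R]
  by (simp add: generic_model_def ultrapower_def real_struct_def generic_eq_alpha[OF G]
      eventually_alpha[OF G])

lemma generic_model_fun_int:
  assumes G: "generic_filter G"
  shows "fun_int (generic_model G) f (map (\<lambda>a. generic_eq G `` {a}) as)
    = generic_eq G `` {\<lambda>i. fun_int real_struct f (map (\<lambda>a. a i) as)}"
  using ultrapower_fun_int[of as real_struct f "alpha G"]
  by (simp add: generic_model_def ultrapower_def real_struct_def generic_eq_alpha[OF G])

end

theory Submission
  imports Defs
begin

text \<open>
  The two isomorphisms are in fact equalities.  A generic filter \<open>G\<close> enters the definition of its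
  model only through the question whether a predicate belongs to some \<open>F \<in> G\<close>, and by
  \<open>eventually_alpha\<close> that says exactly that the predicate belongs to \<open>\<alpha>(G)\<close>.  Hence
  \<open>\<R>\<^sub>G\<close> has the same classes, relations and operations as the ultrapower by \<open>\<alpha>(G)\<close>
  (\<open>generic_model_eq_ultrapower\<close>).  For the other direction it remains to recover \<open>U\<close> from
  \<open>\<beta>(U)\<close>, and \<open>\<alpha>(\<beta>(U)) = U\<close> because \<open>U\<close> itself is the largest filter, as a set, in
  \<open>\<beta>(U)\<close> (\<open>alpha_beta\<close>).  Since isomorphic structures have to be structures, one also needs that
  the operations of an ultrapower stay inside its universe (\<open>is_fo_struct_ultrapower\<close>).
\<close>

lemma fo_isomorphic_refl: "is_fo_struct L M \<Longrightarrow> fo_isomorphic L M M"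
  by (auto simp: fo_isomorphic_def fo_iso_def bij_betw_def intro: exI[where x = id])

text \<open>
  A tuple of classes is the tuple of classes of some representatives, so the pointwise description
  \<open>ultrapower_fun_int\<close> applies to every tuple from the universe.
\<close>

lemma is_fo_struct_ultrapower:
  assumes M: "is_fo_struct L M"
  shows "is_fo_struct L (ultrapower M U)"
  unfolding is_fo_struct_def
proof (intro conjI ballI)
  let ?S = "{a. range a \<subseteq> universe M}"
  let ?cl = "\<lambda>a. ultra_eq (universe M) U `` {a}"
  have univ: "universe (ultrapower M U) = ?cl ` ?S"
    by (auto simp: ultrapower_def quotient_def)
  obtain m where "m \<in> universe M" using M by (auto simp: is_fo_struct_def)
  then have "(\<lambda>_. m) \<in> ?S" by auto
  then show "universe (ultrapower M U) \<noteq> {}" unfolding univ image_is_empty by (metis empty_iff)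
  fix f cs
  assume f: "f \<in> fun_syms L" and cs: "cs \<in> tuples (fun_arity L f) (universe (ultrapower M U))"
  from cs have "cs \<in> lists (?cl ` ?S)" by (simp add: tuples_def univ lists_eq_set)
  then obtain as where as: "as \<in> lists ?S" and cs_eq: "cs = map ?cl as"
    unfolding lists_image by (rule imageE)
  have reps: "set as \<subseteq> ?S" using as by auto
  have len: "length as = fun_arity L f" using cs cs_eq by (simp add: tuples_def)
  have closed: "fun_int M f xs \<in> universe M"
    if "length xs = length as" "set xs \<subseteq> universe M" for xs
    using M f len that by (auto simp: is_fo_struct_def tuples_def)
  let ?p = "\<lambda>i. fun_int M f (map (\<lambda>a. a i) as)"
  have "?p i \<in> universe M" for i using reps by (intro closed) auto
  then have "?p \<in> ?S" by auto
  then have "?cl ?p \<in> ?cl ` ?S" by (rule imageI)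
  moreover have "fun_int (ultrapower M U) f cs = ?cl ?p"
    unfolding cs_eq by (rule ultrapower_fun_int[OF reps]) (rule closed)
  ultimately show "fun_int (ultrapower M U) f cs \<in> universe (ultrapower M U)"
    by (simp only: univ)
qed

lemma is_fo_struct_real: "is_fo_struct real_lang real_struct"
  by (simp add: is_fo_struct_def real_struct_def)

lemma generic_model_eq_ultrapower:
  assumes G: "generic_filter G"
  shows "generic_model G = ultrapower real_struct (alpha G)"
  unfolding generic_model_def ultrapower_def generic_eq_alpha[OF G] eventually_alpha[OF G]
  by (simp add: real_struct_def)

lemma alpha_beta:
  assumes U: "nonprincipal_ultrafilter U"
  shows "alpha (beta U) = U"
proof -
  have "U \<in> beta U" using nonprincipal_in_Frk[OF U] by (simp add: beta_def)
  then have "eventually P (alpha (beta U)) \<longleftrightarrow> eventually P U" for P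
    unfolding eventually_alpha[OF generic_beta[OF U]] by (auto simp: beta_def dest: filter_leD)
  then show ?thesis by (simp add: filter_eq_iff)
qed

theorem theorem6p4:
  shows "(\<forall>U :: nat filter. nonprincipal_ultrafilter U \<longrightarrow>
            fo_isomorphic real_lang (ultrapower real_struct U) (generic_model (beta U))) \<and>
         (\<forall>G :: nat filter set. generic_filter G \<longrightarrow>
            fo_isomorphic real_lang (generic_model G) (ultrapower real_struct (alpha G)))"
proof -
  have refl: "fo_isomorphic real_lang (ultrapower real_struct U) (ultrapower real_struct U)"
    for U :: "nat filter"
    by (intro fo_isomorphic_refl is_fo_struct_ultrapower is_fo_struct_real)
  then show ?thesis
    by (simp add: generic_model_eq_ultrapower generic_beta alpha_beta)
qed

end
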